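(* For an integer $n\geq 0$, the Francois quaternion $\mathbb{Q}\mathcal{F}_{n}$ is a zero divisor in the quaternion algebra $\mathbb{Q}_{\mathbb{Z}_{3}}$ if and only if $n\equiv 0,1,6 \pmod 8$.
   Context: The Francois numbers are defined by $\mathcal{F}_{0}=2$, $\mathcal{F}_{1}=1$, $\mathcal{F}_{n}=\mathcal{F}_{n-1}+\mathcal{F}_{n-2}+1$ for $n\geq 2$. For an odd prime $q$, let $\mathbb{Z}_q$ be the field with $q$ elements and $\mathbb{Q}_{\mathbb{Z}_{q}}$ the quaternion algebra over $\mathbb{Z}_q$ with basis $1,i,j,k$ and relations $i^{2}=j^{2}=-1$, $ij=-ji=k$. The $n$-th Francois quaternion is $\mathbb{Q}\mathcal{F}_{n}=\mathcal{F}_{n}+\mathcal{F}_{n+1}i+\mathcal{F}_{n+2}j+\mathcal{F}_{n+3}k$, regarded as an element of $\mathbb{Q}_{\mathbb{Z}_{q}}$ by reducing its coefficients modulo $q$. *)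

theory Defs
  imports Complex_Main "HOL-Library.Numeral_Type"
begin

fun francois :: "nat \<Rightarrow> nat" where
  "francois 0 = 2"
| "francois (Suc 0) = 1"
| "francois (Suc (Suc n)) = francois (Suc n) + francois n + 1"

text \<open>
  \<open>Quat a b c d\<close> stands for \<open>a + b i + c j + d k\<close>. The product below is the bilinear extension
  of \<open>i\<^sup>2 = j\<^sup>2 = -1\<close>, \<open>i j = - j i = k\<close>; see \<open>quat_units\<close>.
\<close>

datatype 'a quat = Quat (q0: 'a) (q1: 'a) (q2: 'a) (q3: 'a)

instantiation quat :: (comm_ring_1) ring_1
begin

definition zero_quat :: "'a quat" where
  "0 = Quat 0 0 0 0"

definition one_quat :: "'a quat" where
  "1 = Quat 1 0 0 0"

definition plus_quat :: "'a quat \<Rightarrow> 'a quat \<Rightarrow> 'a quat" where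
  "x + y = Quat (q0 x + q0 y) (q1 x + q1 y) (q2 x + q2 y) (q3 x + q3 y)"

definition uminus_quat :: "'a quat \<Rightarrow> 'a quat" where
  "- x = Quat (- q0 x) (- q1 x) (- q2 x) (- q3 x)"

definition minus_quat :: "'a quat \<Rightarrow> 'a quat \<Rightarrow> 'a quat" where
  "x - y = Quat (q0 x - q0 y) (q1 x - q1 y) (q2 x - q2 y) (q3 x - q3 y)"

definition times_quat :: "'a quat \<Rightarrow> 'a quat \<Rightarrow> 'a quat" where
  "x * y = Quat
     (q0 x * q0 y - q1 x * q1 y - q2 x * q2 y - q3 x * q3 y)
     (q0 x * q1 y + q1 x * q0 y + q2 x * q3 y - q3 x * q2 y)
     (q0 x * q2 y - q1 x * q3 y + q2 x * q0 y + q3 x * q1 y)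
     (q0 x * q3 y + q1 x * q2 y - q2 x * q1 y + q3 x * q0 y)"

instance
  by standard
    (simp_all add: zero_quat_def one_quat_def plus_quat_def uminus_quat_def minus_quat_def
      times_quat_def algebra_simps)

end

definition quat_of :: "'a::comm_ring_1 \<Rightarrow> 'a quat" where
  "quat_of a = Quat a 0 0 0"

definition quat_i :: "'a::comm_ring_1 quat" where
  "quat_i = Quat 0 1 0 0"

definition quat_j :: "'a::comm_ring_1 quat" where
  "quat_j = Quat 0 0 1 0"

definition quat_k :: "'a::comm_ring_1 quat" where
  "quat_k = Quat 0 0 0 1"

lemma quat_units:
  "quat_i * quat_i = (-1 :: 'a::comm_ring_1 quat)"
  "quat_j * quat_j = (-1 :: 'a quat)"
  "quat_i * quat_j = (quat_k :: 'a quat)"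
  "quat_j * quat_i = - (quat_k :: 'a quat)"
  by (simp_all add: quat_i_def quat_j_def quat_k_def times_quat_def uminus_quat_def one_quat_def)

lemma Quat_eq_basis_expansion:
  "Quat a b c d = quat_of a + quat_of b * quat_i + quat_of c * quat_j + quat_of d * quat_k"
  by (simp add: quat_of_def quat_i_def quat_j_def quat_k_def times_quat_def plus_quat_def)

lemma quat_of_central: "quat_of a * x = x * quat_of a"
  by (simp add: quat_of_def times_quat_def mult.commute)

text \<open>
  In the ring \<open>'a\<close> the integer coefficients are read through \<open>of_nat\<close>; for a numeral type
  such as \<open>3\<close>, whose ring operations are those of the integers modulo 3, this is reduction
  of the coefficients.
\<close>

definition francois_quat :: "nat \<Rightarrow> 'a::comm_ring_1 quat" where
  "francois_quat n =
     quat_of (of_nat (francois n)) + quat_of (of_nat (francois (n + 1))) * quat_i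
     + quat_of (of_nat (francois (n + 2))) * quat_j + quat_of (of_nat (francois (n + 3))) * quat_k"

text \<open>The ring need not be commutative, so one-sided zero divisors on either side count.\<close>

definition zero_divisor :: "'a::ring \<Rightarrow> bool" where
  "zero_divisor x \<longleftrightarrow> x \<noteq> 0 \<and> (\<exists>y. y \<noteq> 0 \<and> (x * y = 0 \<or> y * x = 0))"

end

theory Submission imports Defs begin

text \<open>
  Whether a quaternion is a zero divisor can be read off its norm: both \<open>x\<close> times its
  conjugate and the conjugate times \<open>x\<close> equal the scalar norm, the sum of the four squared
  coefficients. Over the integers modulo 3 the norm is zero or a unit. In the first case the
  conjugate is a witness that a nonzero \<open>x\<close> is a zero divisor; in the second \<open>x\<close> is a unit and
  therefore not one (\<open>zero_divisor_mod_3_iff\<close>).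

  Eight steps of the recurrence give \<open>F\<^sub>n\<^sub>+\<^sub>8 = 13 F\<^sub>n + 21 F\<^sub>n\<^sub>+\<^sub>1 + 33\<close>, so modulo 3 the
  sequence has period 8 (\<open>of_nat_francois_mod_8\<close>), running through 2, 1, 1, 0, 2, 0, 0, 1.
  Among these cyclic residues every window of length four contains a nonzero entry, and as a
  nonzero residue has square 1, the norm of the quaternion is the number of nonzero entries
  in its window. That number is 3, hence zero modulo 3, exactly for the windows starting at
  positions 0, 1 and 6; otherwise it is 1, 2 or 4.
\<close>

definition quat_conj :: "'a::comm_ring_1 quat \<Rightarrow> 'a quat" where
  "quat_conj x = Quat (q0 x) (- q1 x) (- q2 x) (- q3 x)"

definition quat_norm :: "'a::comm_ring_1 quat \<Rightarrow> 'a" where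
  "quat_norm x = q0 x * q0 x + q1 x * q1 x + q2 x * q2 x + q3 x * q3 x"

lemma mult_quat_conj: "x * quat_conj x = quat_of (quat_norm x)"
  and quat_conj_mult: "quat_conj x * x = quat_of (quat_norm x)"
  by (simp_all add: quat_conj_def quat_norm_def quat_of_def times_quat_def algebra_simps)

lemma quat_of_mult: "quat_of (a * b) = quat_of a * quat_of b"
  by (simp add: quat_of_def times_quat_def)

lemma quat_of_0: "quat_of 0 = 0"
  by (simp add: quat_of_def zero_quat_def)

lemma quat_of_1: "quat_of 1 = 1"
  by (simp add: quat_of_def one_quat_def)

lemma quat_conj_eq_0_iff: "quat_conj x = 0 \<longleftrightarrow> x = 0"
  by (cases x) (simp add: quat_conj_def zero_quat_def)

lemma zero_divisor_if_quat_norm_0: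
  assumes "x \<noteq> 0" and "quat_norm x = 0"
  shows "zero_divisor x"
proof -
  have "quat_conj x \<noteq> 0"
    using assms(1) by (simp add: quat_conj_eq_0_iff)
  moreover have "x * quat_conj x = 0"
    by (simp add: mult_quat_conj assms(2) quat_of_0)
  ultimately show ?thesis
    using assms(1) unfolding zero_divisor_def by blast
qed

text \<open>
  Scaling the conjugate by the inverse of the norm gives a two-sided inverse of \<open>x\<close>.
  It is two-sided because scalars are central.
\<close>

lemma not_zero_divisor_if_quat_norm_unit:
  fixes x :: "'a::comm_ring_1 quat"
  assumes "m * quat_norm x = 1"
  shows "\<not> zero_divisor x"
proof -
  define z where "z = quat_of m * quat_conj x"
  have left: "z * x = 1"
    by (simp add: z_def mult.assoc quat_conj_mult assms quat_of_1 flip: quat_of_mult)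
  have "x * z = quat_of m * (x * quat_conj x)"
    by (metis z_def mult.assoc quat_of_central)
  then have right: "x * z = 1"
    by (simp add: mult_quat_conj assms quat_of_1 flip: quat_of_mult)
  have "y = 0" if "x * y = 0" for y
  proof -
    have "y = (z * x) * y" by (simp add: left)
    also have "\<dots> = z * (x * y)" by (rule mult.assoc)
    finally show ?thesis by (simp add: that)
  qed
  moreover have "y = 0" if "y * x = 0" for y
  proof -
    have "y = y * (x * z)" by (simp add: right)
    also have "\<dots> = (y * x) * z" by (rule mult.assoc [symmetric])
    finally show ?thesis by (simp add: that)
  qed
  ultimately show ?thesis
    unfolding zero_divisor_def by blast
qed

text \<open>
  Every nonzero norm is therefore its own inverse, which makes the dichotomy below exhaustive.
\<close>

lemma square_mod_3:
  fixes a :: 3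
  shows "a = 0 \<or> a * a = 1"
proof (cases a rule: bit1_cases)
  case (of_int z)
  then have "z \<in> {0, 1, 2}"
    by auto
  with of_int show ?thesis
    by auto
qed

lemma zero_divisor_mod_3_iff:
  fixes x :: "3 quat"
  shows "zero_divisor x \<longleftrightarrow> x \<noteq> 0 \<and> quat_norm x = 0"
proof
  assume zd: "zero_divisor x"
  then have "quat_norm x * quat_norm x \<noteq> 1"
    using not_zero_divisor_if_quat_norm_unit by blast
  then have "quat_norm x = 0"
    using square_mod_3 by blast
  with zd show "x \<noteq> 0 \<and> quat_norm x = 0"
    unfolding zero_divisor_def by blast
qed (use zero_divisor_if_quat_norm_0 in blast)

text \<open>
  Iterating the recurrence eight times from \<open>F\<^sub>n\<close> and \<open>F\<^sub>n\<^sub>+\<^sub>1\<close> leaves \<open>F\<^sub>n\<close> plus a multiple of 3.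
\<close>

lemma of_nat_francois_add_8: "of_nat (francois (n + 8)) = (of_nat (francois n) :: 3)"
proof -
  \<comment> \<open>Naming the shifted sequence makes its first terms atoms of a linear system, which the
    simplifier solves without unfolding the recursion of \<open>francois\<close>.\<close>
  define f where "f k = francois (n + k)" for k
  have step: "f (k + 2) = f (k + 1) + f k + 1" for k
    by (simp add: f_def)
  have "f 8 = f 0 + 3 * (4 * f 0 + 7 * f 1 + 11)"
    using step[of 0] step[of 1] step[of 2] step[of 3] step[of 4] step[of 5] step[of 6]
    by (simp del: add_2_eq_Suc' One_nat_def)
  then have "francois (n + 8) = francois n + 3 * (4 * francois n + 7 * francois (n + 1) + 11)"
    unfolding f_def by (simp only: add_0_right)
  moreover have "(3 :: 3) = 0"
    by simp
  ultimately show ?thesis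
    by (simp only: of_nat_add of_nat_mult of_nat_numeral mult_zero_left add_0_right)
qed

lemma of_nat_francois_mod_8: "of_nat (francois n) = (of_nat (francois (n mod 8)) :: 3)"
proof (induction n rule: less_induct)
  case (less n)
  show ?case
  proof (cases "n < 8")
    case False
    then have "of_nat (francois (n - 8)) = (of_nat (francois (n mod 8)) :: 3)"
      using less[of "n - 8"] by (simp add: le_mod_geq)
    with False show ?thesis
      using of_nat_francois_add_8[of "n - 8"] by simp
  qed simp
qed

lemma francois_quat_coeffs:
  "francois_quat n =
     Quat (of_nat (francois n)) (of_nat (francois (n + 1)))
       (of_nat (francois (n + 2))) (of_nat (francois (n + 3)))"
  unfolding francois_quat_def by (rule Quat_eq_basis_expansion [symmetric])

lemma francois_quat_mod_8: "francois_quat n = (francois_quat (n mod 8) :: 3 quat)"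
proof -
  have "of_nat (francois (n + k)) = (of_nat (francois (n mod 8 + k)) :: 3)" for k
    by (metis of_nat_francois_mod_8 mod_add_left_eq)
  then show ?thesis
    using of_nat_francois_mod_8[of n] by (simp only: francois_quat_coeffs)
qed

text \<open>
  The windows starting at 0 to 7 reach up to index 10.
\<close>

lemma francois_small:
  "francois 2 = 4" "francois 3 = 6" "francois 4 = 11" "francois 5 = 18" "francois 6 = 30"
  "francois 7 = 49" "francois 8 = 80" "francois 9 = 130" "francois 10 = 211"
  by code_simp+

theorem proposition8:
  fixes n :: nat
  shows "zero_divisor (francois_quat n :: 3 quat) \<longleftrightarrow> n mod 8 \<in> {0, 1, 6}"
proof -
  have "zero_divisor (francois_quat r :: 3 quat) \<longleftrightarrow> r \<in> {0, 1, 6}" if "r < 8" for r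
  proof -
    from that have "r \<in> {0, 1, 2, 3, 4, 5, 6, 7}"
      by auto
    then show ?thesis
      by (auto simp: zero_divisor_mod_3_iff francois_quat_coeffs quat_norm_def zero_quat_def
          francois_small)
  qed
  then show ?thesis
    by (subst francois_quat_mod_8) simp
qed

end
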